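(* The path-based formulation (PBF) and the link-based formulation (LBF) (both defined in the context, for the same data $\mathcal N,\mathcal C,\mathcal R,\mathcal Q,L,L_{\max},N_{\max},K,D$) are equivalent, in the following sense. (i) If $(x_p)_{p\in\mathcal P},(y^p_u)_{u\in\mathcal R}$ is an optimal solution to PBF, then the variables $\tilde x^{q,k}_{uv},\tilde y^l_u$ obtained from it by Construction A form an optimal solution to LBF. (ii) If $(x^{q,k}_{uv}),(y^l_u)_{u\in\mathcal R}$ is an optimal solution to LBF, then the variables $\tilde x_p,\tilde y^p_u$ obtained from it by Construction B form an optimal solution to PBF. (iii) The optimal objective values are equal: $\sum_{u\in\mathcal R}y^l_u=\sum_{u\in\mathcal R}y^p_u$ for optimal solutions of LBF and PBF respectively.
   Context: Setting. Let $G$ be a finite undirected graph with node set $\mathcal N$ and nonnegative edge lengths, $\mathcal C\subset\mathcal N$ a set of end nodes, and $\mathcal R=\mathcal N\setminus\mathcal C$ the potential repeater locations. $\mathcal Q$ is a set that contains, for each unordered pair $\{i,j\}$ of distinct end nodes, exactly one of the ordered pairs $(i,j),(j,i)$ (the choice is arbitrary). For $q=(s,t)\in\mathcal Q$ let $\mathcal E_q=\{(n_1,n_2): n_1\in\mathcal R\cup\{s\},\ n_2\in\mathcal R\cup\{t\},\ n_1\ne n_2\}$; its elements are called elementary links. $L((u,v))$ is the length of a shortest path from $u$ to $v$ in $G$ (a finite nonnegative real number). Parameters: a real $L_{\max}\ge 0$, an integer $N_{\max}\ge 0$, and positive integers $K,D$; $\mathcal K=\{1,\dots,K\}$. Paths.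 For $q=(s,t)\in\mathcal Q$, $\mathcal P_q$ is the set of all sequences $p=((u_0,u_1),(u_1,u_2),\dots,(u_{n-1},u_n))$, $n\ge 1$, of elementary links in $\mathcal E_q$ with $u_0=s$, $u_n=t$ and $u_0,\dots,u_n$ pairwise distinct. $|p|=n$ is the number of elementary links of $p$. $\mathcal P=\bigcup_{q\in\mathcal Q}\mathcal P_q$. For $u\in\mathcal R$, $r_{up}=1$ if $u$ is one of the intermediate nodes $u_1,\dots,u_{n-1}$ of $p$ (i.e. $p$ uses $u$ as a quantum-repeater node), and $r_{up}=0$ otherwise. PBF: minimize $\sum_{u\in\mathcal R}y^p_u$ over $x_p\in\{0,1\}$ ($p\in\mathcal P$), $y^p_u\in\{0,1\}$ ($u\in\mathcal R$; the superscript $p$ in $y^p_u$ is only a tag), subject to - $L((u,v))x_p\le L_{\max}$ for all $p\in\mathcal P$, $(u,v)\in p$; - $|p|x_p\le N_{\max}+1$ for all $p\in\mathcal P$; - $\sum_{p\in\mathcal P_q}x_p=K$ for all $q\in\mathcal Q$; - $\sum_{p\in\mathcal P_q}r_{up}x_p\le 1$ for all $u\in\mathcal R$, $q\in\mathcal Q$; - $\sum_{p\in\mathcal P}r_{up}x_p\le D\,y^p_u$ for all $u\in\mathcal R$. LBF: minimize $\sum_{u\in\mathcal R}y^l_u$ over $x^{q,k}_{uv}\in\{0,1\}$ ($q\in\mathcal Q$, $k\in\mathcal K$, $(u,v)\in\mathcal E_q$), $y^l_u\in\{0,1\}$ ($u\in\mathcal R$), subject to - for all $q=(s,t)\in\mathcal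 Q$, $k\in\mathcal K$, $u\in\mathcal R\cup\{s,t\}$: $\sum_{v:(u,v)\in\mathcal E_q}x^{q,k}_{uv}-\sum_{v:(v,u)\in\mathcal E_q}x^{q,k}_{vu}$ equals $1$ if $u=s$, $-1$ if $u=t$, $0$ if $u\in\mathcal R$; - $L((u,v))x^{q,k}_{uv}\le L_{\max}$ for all $q\in\mathcal Q$, $k\in\mathcal K$, $(u,v)\in\mathcal E_q$; - $\sum_{(u,v)\in\mathcal E_q}x^{q,k}_{uv}\le N_{\max}+1$ for all $q\in\mathcal Q$, $k\in\mathcal K$; - $\sum_{v:(u,v)\in\mathcal E_q}\sum_{k\in\mathcal K}x^{q,k}_{uv}\le 1$ for all $u\in\mathcal R$, $q\in\mathcal Q$; - $\sum_{k\in\mathcal K}x^{q,k}_{st}\le 1$ for all $q=(s,t)\in\mathcal Q$; - $\sum_{q\in\mathcal Q}\sum_{v:(u,v)\in\mathcal E_q}\sum_{k\in\mathcal K}x^{q,k}_{uv}\le D\,y^l_u$ for all $u\in\mathcal R$. An optimal solution is a feasible assignment minimizing the objective. Construction A (from PBF to LBF). Put $\tilde y^l_u=y^p_u$ for all $u\in\mathcal R$ and initialize all $\tilde x^{q,k}_{uv}=0$. For each $q\in\mathcal Q$: set $k=1$; run through the paths $p\in\mathcal P_q$ in some order; whenever $x_p=1$, set $\tilde x^{q,k}_{uv}=1$ for every $(u,v)\in p$ and then increase $k$ by $1$. Construction B (from LBF to PBF). For each $q=(s,t)\in\mathcal Q$ and $k\in\mathcal K$, start with $u_0=s$, $n=0$;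 while $u_n\ne t$, find the unique node $v\in\mathcal R\cup\{t\}$ with $x^{q,k}_{u_nv}=1$, increase $n$ by $1$ and set $u_n=v$. Let $p^{q,k}=((u_0,u_1),\dots,(u_{n-1},u_n))$ be the resulting sequence, and let $\mathcal P^*=\{p^{q,k}:q\in\mathcal Q,k\in\mathcal K\}$. Put $\tilde x_p=1$ for $p\in\mathcal P^*$, $\tilde x_p=0$ for $p\in\mathcal P\setminus\mathcal P^*$, and $\tilde y^p_u=y^l_u$ for all $u\in\mathcal R$. (That this procedure is well defined and gives $\mathcal P^*\subseteq\mathcal P$ is part of the assertion.) *)

theory Defs
  imports
    Complex_Main
    "HOL-Library.While_Combinator"
    "Graph_Theory.Shortest_Path"
    "Graph_Theory.Vertex_Walk"
begin

text \<open>
  The fields are, in this order, \<open>G\<close> with its edge lengths, \<open>C\<close>, \<open>Q\<close>, \<open>L_max\<close>, \<open>N_max\<close>,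
  \<open>K\<close> and \<open>D\<close>.
\<close>

record ('v, 'e) repeater_instance =
  network :: "('v, 'e) pre_digraph"
  edge_length :: "'e \<Rightarrow> real"
  end_nodes :: "'v set"
  demands :: "('v \<times> 'v) set"
  max_link_length :: real
  max_repeaters :: nat
  num_paths :: nat
  capacity :: nat

definition repeater_nodes :: "('v, 'e) repeater_instance \<Rightarrow> 'v set" where
  "repeater_nodes I = verts (network I) - end_nodes I"

definition elementary_links :: "('v, 'e) repeater_instance \<Rightarrow> 'v \<times> 'v \<Rightarrow> ('v \<times> 'v) set" where
  "elementary_links I q =
     {(u, v). u \<in> repeater_nodes I \<union> {fst q} \<and> v \<in> repeater_nodes I \<union> {snd q} \<and> u \<noteq> v}"

text \<open>
  The library distance is an extended real (infinite between disconnected nodes); the locale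
  below makes it finite on every elementary link, so the conversion loses nothing there.
\<close>

definition link_length :: "('v, 'e) repeater_instance \<Rightarrow> 'v \<times> 'v \<Rightarrow> real" where
  "link_length I e =
     real_of_ereal (wf_digraph.\<mu> (network I) (edge_length I) (fst e) (snd e))"

text \<open>
  As usual in \<open>Graph_Theory\<close>, an undirected graph is a symmetric digraph. Loops and parallel
  edges are not excluded, so undirectedness of the lengths is stated as: each arc has a reverse
  arc of the same length.
\<close>

locale repeater_network =
  fixes I :: "('v, 'e) repeater_instance"
  assumes undirected: "pseudo_graph (network I)"
    and length_nonneg: "e \<in> arcs (network I) \<Longrightarrow> 0 \<le> edge_length I e"
    and length_symmetric: "e \<in> arcs (network I) \<Longrightarrow>
      \<exists>e' \<in> arcs (network I). tail (network I) e' = head (network I) e \<and>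
        head (network I) e' = tail (network I) e \<and> edge_length I e' = edge_length I e"
    and end_nodes_subset: "end_nodes I \<subseteq> verts (network I)"
    and demands_subset: "demands I \<subseteq> {(i, j). i \<in> end_nodes I \<and> j \<in> end_nodes I \<and> i \<noteq> j}"
    and demands_one_orientation: "\<lbrakk>i \<in> end_nodes I; j \<in> end_nodes I; i \<noteq> j\<rbrakk> \<Longrightarrow>
      ((i, j) \<in> demands I) \<noteq> ((j, i) \<in> demands I)"
    and links_connected: "\<lbrakk>q \<in> demands I; (u, v) \<in> elementary_links I q\<rbrakk> \<Longrightarrow>
      u \<rightarrow>\<^sup>*\<^bsub>network I\<^esub> v"
    and max_link_length_nonneg: "0 \<le> max_link_length I"
    and num_paths_pos: "0 < num_paths I"
    and capacity_pos: "0 < capacity I"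


subsection \<open>Paths\<close>

text \<open>
  \<^term>\<open>vwalk_arcs [u\<^sub>0, u\<^sub>1, u\<^sub>2]\<close> is \<^term>\<open>[(u\<^sub>0, u\<^sub>1), (u\<^sub>1, u\<^sub>2)]\<close>, and so on.
\<close>

definition demand_paths :: "('v, 'e) repeater_instance \<Rightarrow> 'v \<times> 'v \<Rightarrow> ('v \<times> 'v) list set" where
  "demand_paths I q =
     {vwalk_arcs us | us. length us \<ge> 2 \<and> hd us = fst q \<and> last us = snd q \<and> distinct us \<and>
        set (vwalk_arcs us) \<subseteq> elementary_links I q}"

definition all_paths :: "('v, 'e) repeater_instance \<Rightarrow> ('v \<times> 'v) list set" where
  "all_paths I = (\<Union>q \<in> demands I. demand_paths I q)"

text \<open>
  The coefficient \<open>r\<^sub>u\<^sub>p\<close>: the intermediate nodes of a path are the heads of all its links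
  but the last.
\<close>

definition uses_repeater :: "'v \<Rightarrow> ('v \<times> 'v) list \<Rightarrow> real" where
  "uses_repeater u p = (if u \<in> snd ` set (butlast p) then 1 else 0)"


subsection \<open>The two integer programs\<close>

text \<open>
  Assignments are total functions; the constraints read them only on the index sets of the
  variables.
\<close>

definition objective :: "('v, 'e) repeater_instance \<Rightarrow> ('v \<Rightarrow> real) \<Rightarrow> real" where
  "objective I y = (\<Sum>u \<in> repeater_nodes I. y u)"

definition pbf_feasible ::
  "('v, 'e) repeater_instance \<Rightarrow> (('v \<times> 'v) list \<Rightarrow> real) \<Rightarrow> ('v \<Rightarrow> real) \<Rightarrow> bool" where
  "pbf_feasible I x y \<longleftrightarrow>
     (\<forall>p \<in> all_paths I. x p \<in> {0, 1}) \<and>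
     (\<forall>u \<in> repeater_nodes I. y u \<in> {0, 1}) \<and>
     (\<forall>p \<in> all_paths I. \<forall>e \<in> set p. link_length I e * x p \<le> max_link_length I) \<and>
     (\<forall>p \<in> all_paths I. real (length p) * x p \<le> real (max_repeaters I) + 1) \<and>
     (\<forall>q \<in> demands I. (\<Sum>p \<in> demand_paths I q. x p) = real (num_paths I)) \<and>
     (\<forall>u \<in> repeater_nodes I. \<forall>q \<in> demands I.
        (\<Sum>p \<in> demand_paths I q. uses_repeater u p * x p) \<le> 1) \<and>
     (\<forall>u \<in> repeater_nodes I.
        (\<Sum>p \<in> all_paths I. uses_repeater u p * x p) \<le> real (capacity I) * y u)"

definition pbf_optimal ::
  "('v, 'e) repeater_instance \<Rightarrow> (('v \<times> 'v) list \<Rightarrow> real) \<Rightarrow> ('v \<Rightarrow> real) \<Rightarrow> bool" where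
  "pbf_optimal I x y \<longleftrightarrow>
     pbf_feasible I x y \<and> (\<forall>x' y'. pbf_feasible I x' y' \<longrightarrow> objective I y \<le> objective I y')"

definition lbf_feasible ::
  "('v, 'e) repeater_instance \<Rightarrow> ('v \<times> 'v \<Rightarrow> nat \<Rightarrow> 'v \<times> 'v \<Rightarrow> real) \<Rightarrow> ('v \<Rightarrow> real) \<Rightarrow> bool" where
  "lbf_feasible I x y \<longleftrightarrow>
     (\<forall>q \<in> demands I. \<forall>k \<in> {1..num_paths I}. \<forall>e \<in> elementary_links I q. x q k e \<in> {0, 1}) \<and>
     (\<forall>u \<in> repeater_nodes I. y u \<in> {0, 1}) \<and>
     (\<forall>q \<in> demands I. \<forall>k \<in> {1..num_paths I}. \<forall>u \<in> repeater_nodes I \<union> {fst q, snd q}.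
        (\<Sum>v | (u, v) \<in> elementary_links I q. x q k (u, v)) -
        (\<Sum>v | (v, u) \<in> elementary_links I q. x q k (v, u)) =
        (if u = fst q then 1 else if u = snd q then -1 else 0)) \<and>
     (\<forall>q \<in> demands I. \<forall>k \<in> {1..num_paths I}. \<forall>e \<in> elementary_links I q.
        link_length I e * x q k e \<le> max_link_length I) \<and>
     (\<forall>q \<in> demands I. \<forall>k \<in> {1..num_paths I}.
        (\<Sum>e \<in> elementary_links I q. x q k e) \<le> real (max_repeaters I) + 1) \<and>
     (\<forall>u \<in> repeater_nodes I. \<forall>q \<in> demands I.
        (\<Sum>v | (u, v) \<in> elementary_links I q. \<Sum>k = 1..num_paths I. x q k (u, v)) \<le> 1) \<and>
     (\<forall>q \<in> demands I. (\<Sum>k = 1..num_paths I. x q k q) \<le> 1) \<and>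
     (\<forall>u \<in> repeater_nodes I.
        (\<Sum>q \<in> demands I. \<Sum>v | (u, v) \<in> elementary_links I q. \<Sum>k = 1..num_paths I.
           x q k (u, v)) \<le> real (capacity I) * y u)"

definition lbf_optimal ::
  "('v, 'e) repeater_instance \<Rightarrow> ('v \<times> 'v \<Rightarrow> nat \<Rightarrow> 'v \<times> 'v \<Rightarrow> real) \<Rightarrow> ('v \<Rightarrow> real) \<Rightarrow> bool" where
  "lbf_optimal I x y \<longleftrightarrow>
     lbf_feasible I x y \<and> (\<forall>x' y'. lbf_feasible I x' y' \<longrightarrow> objective I y \<le> objective I y')"


subsection \<open>From paths to links\<close>

definition path_enumeration ::
  "('v, 'e) repeater_instance \<Rightarrow> ('v \<times> 'v \<Rightarrow> ('v \<times> 'v) list list) \<Rightarrow> bool" where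
  "path_enumeration I ps \<longleftrightarrow>
     (\<forall>q \<in> demands I. distinct (ps q) \<and> set (ps q) = demand_paths I q)"

text \<open>The loop state consists of the counter \<open>k\<close> and the link variables assigned so far.\<close>

fun add_path :: "(('v \<times> 'v) list \<Rightarrow> real) \<Rightarrow> ('v \<times> 'v) list \<Rightarrow>
    nat \<times> (nat \<Rightarrow> 'v \<times> 'v \<Rightarrow> real) \<Rightarrow> nat \<times> (nat \<Rightarrow> 'v \<times> 'v \<Rightarrow> real)" where
  "add_path x p (k, z) =
     (if x p = 1 then (k + 1, z(k := (\<lambda>e. if e \<in> set p then 1 else z k e))) else (k, z))"

definition links_of_paths ::
  "('v \<times> 'v \<Rightarrow> ('v \<times> 'v) list list) \<Rightarrow> (('v \<times> 'v) list \<Rightarrow> real) \<Rightarrow>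
     'v \<times> 'v \<Rightarrow> nat \<Rightarrow> 'v \<times> 'v \<Rightarrow> real" where
  "links_of_paths ps x q = snd (fold (add_path x) (ps q) (1, \<lambda>k e. 0))"


subsection \<open>From links to paths\<close>

text \<open>
  \<open>successor\<close> restricts \<open>v\<close> to elementary links because \<open>x q k (u, v)\<close> is a variable of the
  program only for these; in particular \<open>v\<close> is a repeater node or the target.
\<close>

definition successor ::
  "('v, 'e) repeater_instance \<Rightarrow> ('v \<times> 'v \<Rightarrow> nat \<Rightarrow> 'v \<times> 'v \<Rightarrow> real) \<Rightarrow> 'v \<times> 'v \<Rightarrow> nat \<Rightarrow>
     'v \<Rightarrow> 'v \<Rightarrow> bool" where
  "successor I x q k u v \<longleftrightarrow> (u, v) \<in> elementary_links I q \<and> x q k (u, v) = 1"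

text \<open>
  The loop state is the list of the nodes \<open>u\<^sub>0, \<dots>, u\<^sub>n\<close> found so far; the result is
  \<^const>\<open>None\<close> if the loop does not terminate.
\<close>

definition trace_nodes ::
  "('v, 'e) repeater_instance \<Rightarrow> ('v \<times> 'v \<Rightarrow> nat \<Rightarrow> 'v \<times> 'v \<Rightarrow> real) \<Rightarrow> 'v \<times> 'v \<Rightarrow> nat \<Rightarrow>
     'v list option" where
  "trace_nodes I x q k =
     while_option (\<lambda>us. last us \<noteq> snd q) (\<lambda>us. us @ [THE v. successor I x q k (last us) v])
       [fst q]"

text \<open>
  The procedure is well defined if it terminates and the node looked for in each iteration
  exists and is unique.
\<close>

definition trace_well_defined ::
  "('v, 'e) repeater_instance \<Rightarrow> ('v \<times> 'v \<Rightarrow> nat \<Rightarrow> 'v \<times> 'v \<Rightarrow> real) \<Rightarrow> 'v \<times> 'v \<Rightarrow> nat \<Rightarrow>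
     bool" where
  "trace_well_defined I x q k \<longleftrightarrow>
     (\<exists>us. trace_nodes I x q k = Some us \<and>
        (\<forall>u \<in> set (butlast us). \<exists>!v. successor I x q k u v))"

definition traced_path ::
  "('v, 'e) repeater_instance \<Rightarrow> ('v \<times> 'v \<Rightarrow> nat \<Rightarrow> 'v \<times> 'v \<Rightarrow> real) \<Rightarrow> 'v \<times> 'v \<Rightarrow> nat \<Rightarrow>
     ('v \<times> 'v) list" where
  "traced_path I x q k = vwalk_arcs (the (trace_nodes I x q k))"

definition traced_paths ::
  "('v, 'e) repeater_instance \<Rightarrow> ('v \<times> 'v \<Rightarrow> nat \<Rightarrow> 'v \<times> 'v \<Rightarrow> real) \<Rightarrow> ('v \<times> 'v) list set" where
  "traced_paths I x = {traced_path I x q k | q k. q \<in> demands I \<and> k \<in> {1..num_paths I}}"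

definition paths_of_links ::
  "('v, 'e) repeater_instance \<Rightarrow> ('v \<times> 'v \<Rightarrow> nat \<Rightarrow> 'v \<times> 'v \<Rightarrow> real) \<Rightarrow>
     ('v \<times> 'v) list \<Rightarrow> real" where
  "paths_of_links I x p = (if p \<in> traced_paths I x then 1 else 0)"

end

theory Submission
  imports Defs
begin

section \<open>Walks as lists of links\<close>

text \<open>Both objectives see only the repeater variables \<open>y\<close>, and neither
  construction changes them. Hence it suffices that each construction turns feasible points into
  feasible points: the programs then have the same feasible \<open>y\<close>, so optimality and
  optimal values carry over.

  From paths to links (\<open>lbf_feasible_if_layers_are_paths\<close>), the K chosen paths of a
  demand become K layers. A simple path is a unit flow, and its flow out of a repeater
  \<open>u\<close> is exactly the coefficient \<open>uses_repeater u p\<close>, so the usage sums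
  agree. Only the one-link path contains the link from source to target, so the layers use that link
  at most once.

  From links to paths (\<open>pbf_feasible_paths_of_links\<close>), a layer may hold a path plus
  disjoint cycles. In- and out-degrees of repeaters are at most one, so the walk from the source
  never meets itself and must reach the target (\<open>trace_invariant_step\<close>,
  \<open>trace_terminates\<close>). The cycles are dropped, which only lowers usage. The K walks of
  a demand differ (\<open>inj_traced_path\<close>): two equal ones would share a repeater or the
  direct link, exceeding a bound of 1.\<close>

lemma map_fst_vwalk_arcs: "map fst (vwalk_arcs us) = butlast us"
  by (induction us rule: vwalk_arcs.induct) auto

lemma map_snd_vwalk_arcs: "map snd (vwalk_arcs us) = tl us"
  by (induction us rule: vwalk_arcs.induct) auto

lemma fst_set_vwalk_arcs: "fst ` set (vwalk_arcs us) = set (butlast us)"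
  by (metis list.set_map map_fst_vwalk_arcs)

lemma snd_set_vwalk_arcs: "snd ` set (vwalk_arcs us) = set (tl us)"
  by (metis list.set_map map_snd_vwalk_arcs)

text \<open>Distinct tails leave at most one link of \<open>p\<close> out of \<open>u\<close>, so
  the out-degree of \<open>u\<close> in \<open>p\<close> is an indicator.\<close>

lemma sum_of_bool_out:
  assumes "finite E" "set p \<subseteq> E" "distinct (map fst p)"
  shows "(\<Sum>v | (u, v) \<in> E. of_bool ((u, v) \<in> set p)) = (of_bool (u \<in> fst ` set p) :: real)"
proof -
  have fin: "finite {v. (u, v) \<in> E}"
    using finite_vimageI[OF assms(1), of "Pair u"] by (simp add: inj_on_def vimage_def)
  have eq: "{v. (u, v) \<in> E} \<inter> {v. (u, v) \<in> set p} = {v. (u, v) \<in> set p}"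
    using assms(2) by auto
  have "card {v. (u, v) \<in> set p} = of_bool (u \<in> fst ` set p)"
  proof (cases "u \<in> fst ` set p")
    case True
    then obtain v where "(u, v) \<in> set p" by auto
    then have "{v. (u, v) \<in> set p} = {v}"
      using assms(3) by (auto dest: eq_key_imp_eq_value)
    then show ?thesis using True by simp
  next
    case False
    then have "{v. (u, v) \<in> set p} = {}" by force
    then show ?thesis using False by simp
  qed
  then show ?thesis using fin by (simp add: sum_of_bool_eq eq)
qed

lemma sum_of_bool_in:
  assumes "finite E" "set p \<subseteq> E" "distinct (map snd p)"
  shows "(\<Sum>v | (v, u) \<in> E. of_bool ((v, u) \<in> set p)) = (of_bool (u \<in> snd ` set p) :: real)"
proof -
  \<comment> \<open>Reversing every link exchanges heads and tails and reduces the claim to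
    \<open>sum_of_bool_out\<close>.\<close>
  let ?p = "map prod.swap p"
  have *: "(\<Sum>v | (u, v) \<in> E\<inverse>. of_bool ((u, v) \<in> set ?p)) = (of_bool (u \<in> fst ` set ?p) :: real)"
    using assms by (intro sum_of_bool_out) (auto simp: comp_def)
  have "(u, v) \<in> prod.swap ` set p \<longleftrightarrow> (v, u) \<in> set p" for v
    by (auto intro: rev_image_eqI)
  with * show ?thesis
    by (simp add: image_image)
qed

section \<open>Sums over selected elements\<close>

text \<open>The bridge between the programs: a weighted sum over paths becomes a sum over layers
  once \<open>\<pi>\<close> enumerates the chosen paths.\<close>

lemma sum_selected:
  fixes f :: "'a \<Rightarrow> real"
  assumes "finite P" "\<And>p. p \<in> P \<Longrightarrow> x p \<in> {0, 1}" "bij_betw \<pi> A {p \<in> P. x p = 1}"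
  shows "(\<Sum>p\<in>P. f p * x p) = (\<Sum>k\<in>A. f (\<pi> k))"
proof -
  have "(\<Sum>p\<in>P. f p * x p) = (\<Sum>p\<in>{p \<in> P. x p = 1}. f p)"
    using assms(1,2) by (intro sum.mono_neutral_cong_right) auto
  also have "\<dots> = (\<Sum>k\<in>A. f (\<pi> k))"
    by (rule sum.reindex_bij_betw[OF assms(3), symmetric])
  finally show ?thesis .
qed

lemma sum_binary_eq_card:
  fixes x :: "'a \<Rightarrow> real"
  assumes "finite A" "\<And>a. a \<in> A \<Longrightarrow> x a \<in> {0, 1}"
  shows "sum x A = card {a \<in> A. x a = 1}"
proof -
  have "bij_betw id {a \<in> A. x a = 1} {a \<in> A. x a = 1}" by simp
  from sum_selected[OF assms this, of "\<lambda>_. 1"] show ?thesis by simp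
qed

text \<open>Serves to refute a constraint with right-hand side 1 when two layers coincide.\<close>

lemma sum_ge_two:
  fixes x :: "'a \<Rightarrow> real"
  assumes "finite A" "\<And>a. a \<in> A \<Longrightarrow> 0 \<le> x a" "a \<in> A" "b \<in> A" "a \<noteq> b" "x a = 1" "x b = 1"
  shows "2 \<le> sum x A"
proof -
  have "sum x {a, b} \<le> sum x A"
    using assms by (intro sum_mono2) auto
  then show ?thesis using assms by simp
qed

section \<open>Demand paths\<close>

context repeater_network
begin

abbreviation "R \<equiv> repeater_nodes I"
abbreviation "E \<equiv> elementary_links I"
abbreviation "P \<equiv> demand_paths I"
abbreviation "K \<equiv> num_paths I"

lemma finite_verts: "finite (verts (network I))"
  using undirected pseudo_graph_def fin_digraph.finite_verts by blast

lemma finite_repeater_nodes: "finite R"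
  using finite_verts by (simp add: repeater_nodes_def)

lemma finite_demands: "finite (demands I)"
proof (rule finite_subset)
  show "demands I \<subseteq> verts (network I) \<times> verts (network I)"
    using demands_subset end_nodes_subset by auto
qed (simp add: finite_verts)

lemma finite_links: "finite (E q)"
proof (rule finite_subset)
  show "E q \<subseteq> (R \<union> {fst q}) \<times> (R \<union> {snd q})"
    by (auto simp: elementary_links_def)
qed (simp add: finite_repeater_nodes)

lemma finite_successors: "finite {v. (u, v) \<in> E q}"
  using finite_vimageI[OF finite_links, of "Pair u"] by (simp add: inj_on_def vimage_def)

lemma finite_predecessors: "finite {v. (v, u) \<in> E q}"
  using finite_vimageI[OF finite_links, of "\<lambda>v. (v, u)"] by (simp add: inj_on_def vimage_def)

lemma demand_ends:
  assumes "q \<in> demands I"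
  shows "fst q \<notin> R" "snd q \<notin> R" "fst q \<noteq> snd q"
  using assms demands_subset by (auto simp: repeater_nodes_def)

text \<open>Exposes the intermediate nodes as the list \<open>ms\<close>, the normal form on which
  most later arguments rest.\<close>

lemma demand_path_iff:
  "p \<in> P q \<longleftrightarrow> (\<exists>ms. p = vwalk_arcs (fst q # ms @ [snd q]) \<and> distinct (fst q # ms @ [snd q]) \<and>
     set p \<subseteq> E q)"
proof -
  have *: "2 \<le> length us \<and> hd us = s \<and> last us = t \<longleftrightarrow> (\<exists>ms. us = s # ms @ [t])" for us and s t :: 'v
  proof
    assume *: "2 \<le> length us \<and> hd us = s \<and> last us = t"
    then obtain vs where vs: "us = s # vs" "vs \<noteq> []"
      by (cases us; cases "tl us") auto
    then have "us = s # butlast vs @ [t]"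
      using * append_butlast_last_id[of vs] by simp
    then show "\<exists>ms. us = s # ms @ [t]" by blast
  qed auto
  have "p \<in> P q \<longleftrightarrow> (\<exists>us. p = vwalk_arcs us \<and>
      (2 \<le> length us \<and> hd us = fst q \<and> last us = snd q) \<and> distinct us \<and> set p \<subseteq> E q)"
    by (auto simp: demand_paths_def)
  then show ?thesis
    unfolding * by blast
qed

lemma demand_pathE:
  assumes "q \<in> demands I" "p \<in> P q"
  obtains ms where "p = vwalk_arcs (fst q # ms @ [snd q])" "distinct (fst q # ms @ [snd q])"
    "set p \<subseteq> E q" "set ms \<subseteq> R" "fst ` set p = insert (fst q) (set ms)"
    "snd ` set p = insert (snd q) (set ms)" "distinct (map fst p)" "distinct (map snd p)"
    "\<forall>u. uses_repeater u p = of_bool (u \<in> set ms)"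
proof -
  from assms(2) obtain ms where p: "p = vwalk_arcs (fst q # ms @ [snd q])"
    and dist: "distinct (fst q # ms @ [snd q])" and sub: "set p \<subseteq> E q"
    by (auto simp: demand_path_iff)
  have mf: "map fst p = fst q # ms"
    unfolding p map_fst_vwalk_arcs by (simp add: butlast_append)
  have ms: "map snd p = ms @ [snd q]"
    unfolding p map_snd_vwalk_arcs by simp
  have f: "fst ` set p = insert (fst q) (set ms)"
    using arg_cong[OF mf, of set] by simp
  have s: "snd ` set p = insert (snd q) (set ms)"
    using arg_cong[OF ms, of set] by simp
  have "set ms \<subseteq> R"
  proof
    \<comment> \<open>An intermediate node is the tail of an elementary link and differs from the
      source, so it must be a repeater.\<close>
    fix u assume u: "u \<in> set ms"
    then have "u \<in> fst ` set p" using f by simp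
    then have "u \<in> R \<union> {fst q}"
      using sub by (auto simp: elementary_links_def)
    then show "u \<in> R" using u dist by auto
  qed
  moreover have "snd ` set (butlast p) = set ms"
    using arg_cong[OF ms, of butlast] by (metis butlast_snoc map_butlast list.set_map)
  then have "\<forall>u. uses_repeater u p = of_bool (u \<in> set ms)"
    by (simp add: uses_repeater_def)
  moreover have "distinct (map fst p)" "distinct (map snd p)"
    using mf ms dist by auto
  ultimately show ?thesis using that[OF p dist sub _ f s] by blast
qed

lemma finite_demand_paths: "finite (P q)"
proof (rule finite_subset)
  let ?V = "R \<union> {fst q, snd q}"
  show "P q \<subseteq> vwalk_arcs ` {us. set us \<subseteq> ?V \<and> distinct us}"
  proof
    fix p assume "p \<in> P q"
    then obtain ms where p: "p = vwalk_arcs (fst q # ms @ [snd q])"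
      and dist: "distinct (fst q # ms @ [snd q])" and sub: "set p \<subseteq> E q"
      by (auto simp: demand_path_iff)
    have "fst q # ms = map fst p"
      unfolding p map_fst_vwalk_arcs by (simp add: butlast_append)
    then have "insert (fst q) (set ms) = fst ` set p"
      by (metis list.set_map list.simps(15))
    also have "\<dots> \<subseteq> ?V" using sub by (auto simp: elementary_links_def)
    finally show "p \<in> vwalk_arcs ` {us. set us \<subseteq> ?V \<and> distinct us}"
      using p dist by (intro image_eqI[of _ _ "fst q # ms @ [snd q]"]) auto
  qed
  show "finite (vwalk_arcs ` {us. set us \<subseteq> ?V \<and> distinct us})"
    by (intro finite_imageI finite_subset_distinct) (simp add: finite_repeater_nodes)
qed

text \<open>End nodes are not repeaters, so the source is the only tail outside \<open>R\<close> and
  the target the only head outside \<open>R\<close>: a path determines its demand.\<close>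

lemma demand_paths_disjoint:
  assumes "q \<in> demands I" "q' \<in> demands I" "q \<noteq> q'"
  shows "P q \<inter> P q' = {}"
proof (rule ccontr)
  assume "P q \<inter> P q' \<noteq> {}"
  then obtain p where p: "p \<in> P q" "p \<in> P q'" by blast
  obtain ms where 1: "fst ` set p = insert (fst q) (set ms)" "snd ` set p = insert (snd q) (set ms)"
    "set ms \<subseteq> R" by (rule demand_pathE[OF assms(1) p(1)])
  obtain ms' where 2: "fst ` set p = insert (fst q') (set ms')"
    "snd ` set p = insert (snd q') (set ms')" "set ms' \<subseteq> R"
    by (rule demand_pathE[OF assms(2) p(2)])
  have "fst q = fst q'" "snd q = snd q'"
    using 1 2 demand_ends[OF assms(1)] demand_ends[OF assms(2)] by blast+
  then show False using assms(3) by (simp add: prod_eq_iff)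
qed

lemma sum_all_paths: "sum f (all_paths I) = (\<Sum>q\<in>demands I. sum f (P q))"
  unfolding all_paths_def
  by (rule sum.UNION_disjoint) (auto simp: finite_demands finite_demand_paths dest: demand_paths_disjoint)

lemma demand_is_link:
  assumes "q \<in> demands I"
  shows "q \<in> E q"
  using demand_ends[OF assms] by (cases q) (auto simp: elementary_links_def)

text \<open>Tails are distinct, so the direct link can only be the first one; the target then
  follows the source at once and, being visited once, ends the path.\<close>

lemma demand_path_direct:
  assumes "q \<in> demands I" "p \<in> P q" "q \<in> set p"
  shows "p = [q]"
proof -
  obtain ms where p: "p = vwalk_arcs (fst q # ms @ [snd q])" "distinct (fst q # ms @ [snd q])"
    by (rule demand_pathE[OF assms(1,2)])
  show ?thesis
  proof (cases ms)
    case Nil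
    then show ?thesis using p by simp
  next
    case (Cons m ms')
    have "(fst q, m) \<in> set p" using p Cons by simp
    moreover have "(fst q, snd q) \<in> set p" using assms(3) by simp
    moreover have "distinct (map fst p)"
      using p(2) unfolding p(1) map_fst_vwalk_arcs by (simp add: butlast_append)
    ultimately have "m = snd q" by (rule eq_key_imp_eq_value[rotated])
    then show ?thesis using p Cons by simp
  qed
qed

lemma demand_path_no_repeater:
  assumes "q \<in> demands I" "p \<in> P q" "\<And>u. u \<in> R \<Longrightarrow> uses_repeater u p = 0"
  shows "p = [q]"
proof -
  obtain ms where p: "p = vwalk_arcs (fst q # ms @ [snd q])" "set ms \<subseteq> R"
    and *: "\<forall>u. uses_repeater u p = of_bool (u \<in> set ms)"
    by (rule demand_pathE[OF assms(1,2)])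
  have "set ms = {}"
  proof (rule ccontr)
    assume "set ms \<noteq> {}"
    then obtain u where "u \<in> set ms" by (meson ex_in_conv)
    then show False using assms(3)[of u] * p(2) by auto
  qed
  then show ?thesis using p by simp
qed

text \<open>The tails of a path are its source and its intermediate nodes, and the source is no
  repeater. This matches the usage terms of the two programs.\<close>

lemma outgoing_links_of_path:
  assumes "q \<in> demands I" "p \<in> P q" "u \<in> R"
  shows "(\<Sum>v | (u, v) \<in> E q. of_bool ((u, v) \<in> set p)) = uses_repeater u p"
proof -
  obtain ms where p: "set p \<subseteq> E q" "fst ` set p = insert (fst q) (set ms)" "distinct (map fst p)"
    and u: "\<forall>u. uses_repeater u p = of_bool (u \<in> set ms)"
    by (rule demand_pathE[OF assms(1,2)])
  have "(\<Sum>v | (u, v) \<in> E q. of_bool ((u, v) \<in> set p)) = (of_bool (u \<in> fst ` set p) :: real)"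
    by (rule sum_of_bool_out[OF finite_links p(1,3)])
  also have "\<dots> = uses_repeater u p"
    using p(2) u assms(3) demand_ends[OF assms(1)] by auto
  finally show ?thesis .
qed

text \<open>Tails are the source and \<open>ms\<close>, heads are \<open>ms\<close> and the target;
  the indicators of \<open>ms\<close> cancel.\<close>

lemma flow_of_path:
  assumes "q \<in> demands I" "p \<in> P q" "u \<in> R \<union> {fst q, snd q}"
  shows "(\<Sum>v | (u, v) \<in> E q. of_bool ((u, v) \<in> set p)) -
     (\<Sum>v | (v, u) \<in> E q. of_bool ((v, u) \<in> set p)) =
     (if u = fst q then 1 else if u = snd q then -1 else (0::real))"
proof -
  obtain ms where p: "set p \<subseteq> E q" "fst ` set p = insert (fst q) (set ms)" "distinct (map fst p)"
    "snd ` set p = insert (snd q) (set ms)" "distinct (map snd p)" "distinct (fst q # ms @ [snd q])"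
    by (rule demand_pathE[OF assms(1,2)])
  have "(\<Sum>v | (u, v) \<in> E q. of_bool ((u, v) \<in> set p)) = (of_bool (u \<in> fst ` set p) :: real)"
    by (rule sum_of_bool_out[OF finite_links p(1,3)])
  moreover have "(\<Sum>v | (v, u) \<in> E q. of_bool ((v, u) \<in> set p)) = (of_bool (u \<in> snd ` set p) :: real)"
    by (rule sum_of_bool_in[OF finite_links p(1,5)])
  ultimately show ?thesis
    using p(2,4,6) by auto
qed

section \<open>From paths to links\<close>

text \<open>Stated for an arbitrary bijection \<open>\<pi> q\<close> between layers and chosen
  paths, so that the order in which the loop visits the paths is irrelevant.\<close>

lemma lbf_feasible_if_layers_are_paths:
  assumes feas: "pbf_feasible I x y"
    and bij: "\<And>q. q \<in> demands I \<Longrightarrow> bij_betw (\<pi> q) {1..K} {p \<in> P q. x p = 1}"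
    and z: "\<And>q k e. \<lbrakk>q \<in> demands I; k \<in> {1..K}\<rbrakk> \<Longrightarrow> z q k e = of_bool (e \<in> set (\<pi> q k))"
  shows "lbf_feasible I z y"
proof -
  have path: "\<pi> q k \<in> P q" "x (\<pi> q k) = 1" if "q \<in> demands I" "k \<in> {1..K}" for q k
    using bij_betwE[OF bij[OF that(1)]] that(2) by auto
  have sub: "q \<in> demands I \<Longrightarrow> p \<in> P q \<Longrightarrow> p \<in> all_paths I" for p q
    by (auto simp: all_paths_def)
  have bin: "x p \<in> {0, 1}" if "q \<in> demands I" "p \<in> P q" for p q
    using feas sub[OF that] by (auto simp: pbf_feasible_def)
  have usage: "(\<Sum>v | (u, v) \<in> E q. \<Sum>k = 1..K. z q k (u, v)) =
      (\<Sum>p\<in>P q. uses_repeater u p * x p)" if q: "q \<in> demands I" and u: "u \<in> R" for q u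
  proof -
    have "(\<Sum>v | (u, v) \<in> E q. \<Sum>k = 1..K. z q k (u, v)) =
        (\<Sum>k = 1..K. \<Sum>v | (u, v) \<in> E q. of_bool ((u, v) \<in> set (\<pi> q k)))"
      by (subst sum.swap) (simp add: z q)
    also have "\<dots> = (\<Sum>k = 1..K. uses_repeater u (\<pi> q k))"
      using path q u by (intro sum.cong refl outgoing_links_of_path) auto
    also have "\<dots> = (\<Sum>p\<in>P q. uses_repeater u p * x p)"
      by (rule sum_selected[OF finite_demand_paths bin[OF q] bij[OF q], symmetric])
    finally show ?thesis .
  qed
  have direct: "(\<Sum>k = 1..K. z q k q) \<le> 1" if q: "q \<in> demands I" for q
  proof -
    \<comment> \<open>A chosen path through the direct link is \<open>[q]\<close>, and injectivity
      of \<open>\<pi> q\<close> puts it in one layer only.\<close>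
    have "k = k'" if "k \<in> {1..K}" "k' \<in> {1..K}" "q \<in> set (\<pi> q k)" "q \<in> set (\<pi> q k')" for k k'
    proof -
      have "\<pi> q k = \<pi> q k'"
        using demand_path_direct[OF q path(1)[OF q]] that by metis
      then show ?thesis
        using inj_onD[OF bij_betw_imp_inj_on[OF bij[OF q]]] that by blast
    qed
    then have "card ({1..K} \<inter> {k. q \<in> set (\<pi> q k)}) \<le> Suc 0"
      by (subst card_le_Suc0_iff_eq) blast+
    moreover have "(\<Sum>k = 1..K. z q k q) = card ({1..K} \<inter> {k. q \<in> set (\<pi> q k)})"
      using q by (simp add: z sum_of_bool_eq)
    ultimately show ?thesis by simp
  qed
  have size: "(\<Sum>e\<in>E q. z q k e) \<le> real (max_repeaters I) + 1"
    if q: "q \<in> demands I" and k: "k \<in> {1..K}" for q k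
  proof -
    have "(\<Sum>e\<in>E q. z q k e) = card (E q \<inter> set (\<pi> q k))"
      using finite_links by (simp add: z[OF q k] sum_of_bool_eq)
    also have "\<dots> \<le> card (set (\<pi> q k))"
      by (intro of_nat_mono card_mono) auto
    also have "\<dots> \<le> length (\<pi> q k)"
      by (simp add: card_length)
    also have "\<dots> = real (length (\<pi> q k)) * x (\<pi> q k)"
      using path[OF q k] by simp
    also have "\<dots> \<le> real (max_repeaters I) + 1"
      using feas sub[OF q path(1)[OF q k]] unfolding pbf_feasible_def by blast
    finally show ?thesis .
  qed
  have length: "link_length I e * z q k e \<le> max_link_length I"
    if q: "q \<in> demands I" and k: "k \<in> {1..K}" for q k e
  proof (cases "e \<in> set (\<pi> q k)")
    case True
    have "link_length I e * x (\<pi> q k) \<le> max_link_length I"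
      using feas sub[OF q path(1)[OF q k]] True unfolding pbf_feasible_def by blast
    then show ?thesis using True path[OF q k] by (simp add: z[OF q k])
  next
    case False
    \<comment> \<open>Off the path the constraint reads
      \<open>0 \<le> max_link_length I\<close>.\<close>
    then show ?thesis using max_link_length_nonneg by (simp add: z[OF q k])
  qed
  have flow: "(\<Sum>v | (u, v) \<in> E q. z q k (u, v)) - (\<Sum>v | (v, u) \<in> E q. z q k (v, u)) =
      (if u = fst q then 1 else if u = snd q then -1 else 0)"
    if "q \<in> demands I" "k \<in> {1..K}" "u \<in> R \<union> {fst q, snd q}" for q k u
    using flow_of_path[OF that(1) path(1)[OF that(1,2)] that(3)] by (simp add: z[OF that(1,2)])
  show ?thesis
    unfolding lbf_feasible_def
  proof (intro conjI ballI)
    fix u assume u: "u \<in> R"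
    have "(\<Sum>q\<in>demands I. \<Sum>v | (u, v) \<in> E q. \<Sum>k = 1..K. z q k (u, v)) =
        (\<Sum>p\<in>all_paths I. uses_repeater u p * x p)"
      unfolding sum_all_paths by (intro sum.cong refl usage u)
    also have "\<dots> \<le> real (capacity I) * y u"
      using feas u unfolding pbf_feasible_def by blast
    finally show "(\<Sum>q\<in>demands I. \<Sum>v | (u, v) \<in> E q. \<Sum>k = 1..K. z q k (u, v)) \<le>
        real (capacity I) * y u" .
  next
    fix u q assume u: "u \<in> R" and q: "q \<in> demands I"
    show "(\<Sum>v | (u, v) \<in> E q. \<Sum>k = 1..K. z q k (u, v)) \<le> 1"
      unfolding usage[OF q u] using feas u q unfolding pbf_feasible_def by blast
  next
    fix u assume "u \<in> R"
    then show "y u \<in> {0, 1}"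
      using feas unfolding pbf_feasible_def by blast
  qed (simp add: z, (rule flow length size direct; assumption)+)
qed

end

section \<open>Closed form of the loop of Construction A\<close>

text \<open>Each chosen path writes one fresh layer, counted from the initial counter. Counter and
  initial layers are arbitrary so that the induction goes through.\<close>

lemma fold_add_path:
  fixes x ps
  defines "sel \<equiv> filter (\<lambda>p. x p = 1)"
  shows "fold (add_path x) ps (n, z) =
    (n + length (sel ps), \<lambda>k. if n \<le> k \<and> k < n + length (sel ps)
       then \<lambda>e. if e \<in> set (sel ps ! (k - n)) then 1 else z k e else z k)"
proof (induction ps arbitrary: n z)
  case Nil
  then show ?case by (auto simp: sel_def fun_eq_iff)
next
  case (Cons p ps)
  show ?case
  proof (cases "x p = 1")
    case True
    then have sel: "sel (p # ps) = p # sel ps" by (simp add: sel_def)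
    show ?thesis
      using True by (auto simp: Cons.IH sel nth_Cons' fun_eq_iff Suc_diff_Suc)
  next
    case False
    then have "sel (p # ps) = sel ps" by (simp add: sel_def)
    then show ?thesis using False by (auto simp: Cons.IH fun_eq_iff)
  qed
qed

context repeater_network
begin

lemma lbf_feasible_links_of_paths:
  assumes feas: "pbf_feasible I x y" and enum: "path_enumeration I ps"
  shows "lbf_feasible I (links_of_paths ps x) y"
proof -
  define sel where "sel q = filter (\<lambda>p. x p = 1) (ps q)" for q
  \<comment> \<open>Exactly K paths are chosen, so the loop fills precisely the layers 1 to
    K.\<close>
  have len: "length (sel q) = K" if q: "q \<in> demands I" for q
  proof -
    have ps: "distinct (ps q)" "set (ps q) = P q"
      using enum q by (auto simp: path_enumeration_def)
    have "real K = sum x (P q)"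
      using feas q by (simp add: pbf_feasible_def)
    also have "\<dots> = card {p \<in> P q. x p = 1}"
      using feas q by (intro sum_binary_eq_card finite_demand_paths)
        (auto simp: pbf_feasible_def all_paths_def)
    also have "{p \<in> P q. x p = 1} = set (sel q)"
      using ps by (auto simp: sel_def)
    also have "card (set (sel q)) = length (sel q)"
      using ps by (intro distinct_card) (simp add: sel_def)
    finally show ?thesis by simp
  qed
  show ?thesis
  \<comment> \<open>Layers are numbered from 1, list positions from 0.\<close>
  proof (rule lbf_feasible_if_layers_are_paths[OF feas, where \<pi> = "\<lambda>q k. sel q ! (k - 1)"])
    fix q assume q: "q \<in> demands I"
    have ps: "distinct (sel q)" "set (sel q) = {p \<in> P q. x p = 1}"
      using enum q by (auto simp: path_enumeration_def sel_def)
    have "bij_betw (\<lambda>k. k - 1) {1..K} {..<K}"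
      by (rule bij_betw_byWitness[where f' = Suc]) auto
    moreover have "bij_betw ((!) (sel q)) {..<K} (set (sel q))"
      using ps len[OF q] by (intro bij_betw_nth) auto
    ultimately show "bij_betw (\<lambda>k. sel q ! (k - 1)) {1..K} {p \<in> P q. x p = 1}"
      using ps bij_betw_trans[of "\<lambda>k. k - 1" "{1..K}" "{..<K}" "(!) (sel q)"] by (simp add: comp_def)
  next
    fix q k e assume "q \<in> demands I" "k \<in> {1..K}"
    then show "links_of_paths ps x q k e = of_bool (e \<in> set (sel q ! (k - 1)))"
      using len[of q] by (auto simp: links_of_paths_def fold_add_path sel_def)
  qed
qed

lemma path_enumeration_exists: "\<exists>ps. path_enumeration I ps"
proof -
  have "\<exists>ps. distinct ps \<and> set ps = P q" for q
    using finite_distinct_list[OF finite_demand_paths] by blast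
  then show ?thesis unfolding path_enumeration_def by metis
qed

end

section \<open>From links to paths\<close>

text \<open>
  In a feasible solution every node has at most one successor, and by flow conservation every
  repeater at most one predecessor.  A node that is reached therefore cannot be reached again,
  so the walk never closes up and stops at the target.
\<close>

locale lbf_solution = repeater_network I
  for I :: "('v, 'e) repeater_instance" +
  fixes x :: "'v \<times> 'v \<Rightarrow> nat \<Rightarrow> 'v \<times> 'v \<Rightarrow> real" and y :: "'v \<Rightarrow> real"
  assumes feas: "lbf_feasible I x y"
begin

lemma binary: "\<lbrakk>q \<in> demands I; k \<in> {1..K}; e \<in> E q\<rbrakk> \<Longrightarrow> x q k e \<in> {0, 1}"
  using feas by (auto simp: lbf_feasible_def)

lemma nonneg: "\<lbrakk>q \<in> demands I; k \<in> {1..K}; e \<in> E q\<rbrakk> \<Longrightarrow> 0 \<le> x q k e"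
  using binary by fastforce

section \<open>Degrees in a single layer\<close>

context
  fixes q k
  assumes q: "q \<in> demands I" and k: "k \<in> {1..K}"
begin

abbreviation "succ \<equiv> successor I x q k"

lemma out_degree: "(\<Sum>v | (u, v) \<in> E q. x q k (u, v)) = card {v. succ u v}"
  using binary[OF q k] sum_binary_eq_card[OF finite_successors[of u q], of "\<lambda>v. x q k (u, v)"]
  by (simp add: successor_def)

lemma in_degree: "(\<Sum>v | (v, u) \<in> E q. x q k (v, u)) = card {v. succ v u}"
  using binary[OF q k] sum_binary_eq_card[OF finite_predecessors[of u q], of "\<lambda>v. x q k (v, u)"]
  by (simp add: successor_def)

lemma degree_balance:
  assumes "u \<in> R \<union> {fst q, snd q}"
  shows "real (card {v. succ u v}) - real (card {v. succ v u}) =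
    (if u = fst q then 1 else if u = snd q then -1 else 0)"
  using feas q k assms unfolding lbf_feasible_def out_degree[symmetric] in_degree[symmetric] by blast

lemma no_link_into_source: "\<not> succ v (fst q)"
  using demand_ends[OF q] by (auto simp: successor_def elementary_links_def)

lemma no_link_out_of_target: "\<not> succ (snd q) v"
  using demand_ends[OF q] by (auto simp: successor_def elementary_links_def)

lemma source_successor: "\<exists>!v. succ (fst q) v"
proof -
  have "card {v. succ (fst q) v} = 1"
    using degree_balance[of "fst q"] no_link_into_source by simp
  then show ?thesis by (simp add: card_1_singleton_iff set_eq_iff) metis
qed

text \<open>The usage bound covers all layers together; by nonnegativity it bounds each one.\<close>

lemma repeater_out_degree:
  assumes "u \<in> R"
  shows "card {v. succ u v} \<le> 1"
proof -
  have "(\<Sum>v | (u, v) \<in> E q. x q k (u, v)) \<le> (\<Sum>v | (u, v) \<in> E q. \<Sum>k = 1..K. x q k (u, v))"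
    using nonneg[OF q] k by (intro sum_mono member_le_sum) auto
  also have "\<dots> \<le> 1"
    using feas q assms by (auto simp: lbf_feasible_def)
  finally show ?thesis by (simp add: out_degree)
qed

lemma repeater_in_degree:
  assumes "u \<in> R"
  shows "card {v. succ v u} = card {v. succ u v}"
  using degree_balance[of u] assms demand_ends[OF q] by (auto split: if_splits)

lemma finite_succ: "finite {v. succ u v}" "finite {v. succ v u}"
  using finite_subset[OF _ finite_successors, of "{v. succ u v}" u q]
    finite_subset[OF _ finite_predecessors, of "{v. succ v u}" u q]
  by (auto simp: successor_def)

lemma predecessor_unique:
  assumes "u \<in> R" "succ v u" "succ v' u"
  shows "v = v'"
proof -
  have "card {v. succ v u} \<le> Suc 0"
    using repeater_in_degree repeater_out_degree assms(1) by simp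
  then show ?thesis
    using assms finite_succ by (auto simp: card_le_Suc0_iff_eq)
qed

text \<open>A reached node other than the target is a repeater. Its in-degree is positive and equals
  its out-degree, which is at most 1.\<close>

lemma successor_of_reached:
  assumes "succ v u" "u \<noteq> snd q"
  shows "\<exists>!w. succ u w"
proof -
  have u: "u \<in> R" using assms by (auto simp: successor_def elementary_links_def)
  have "card {v. succ v u} \<noteq> 0" using assms finite_succ by auto
  then have "card {w. succ u w} = 1"
    using repeater_in_degree[OF u] repeater_out_degree[OF u] by simp
  then show ?thesis by (simp add: card_1_singleton_iff set_eq_iff) metis
qed

section \<open>Tracing the walk from source to target\<close>

text \<open>The last clause certifies every \<open>THE\<close> already evaluated; it uses
  \<open>butlast\<close> because the successor of the final node is still to be sought.\<close>

definition trace_invariant :: "'v list \<Rightarrow> bool" where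
  "trace_invariant us \<longleftrightarrow> us \<noteq> [] \<and> hd us = fst q \<and> distinct us \<and>
     set (vwalk_arcs us) \<subseteq> {(u, v). succ u v} \<and> (\<forall>u \<in> set (butlast us). \<exists>!v. succ u v)"

lemma trace_invariant_nodes:
  assumes "trace_invariant us"
  shows "set us \<subseteq> R \<union> {fst q, snd q}"
proof -
  have "set (tl us) = snd ` set (vwalk_arcs us)"
    by (simp add: snd_set_vwalk_arcs)
  then have "set (tl us) \<subseteq> R \<union> {snd q}"
    using assms by (auto simp: trace_invariant_def successor_def elementary_links_def)
  then show ?thesis
    using assms by (cases us) (auto simp: trace_invariant_def)
qed

text \<open>The crux is that the new node is fresh: a revisited node would be a repeater with two
  different predecessors.\<close>

lemma trace_invariant_step:
  assumes inv: "trace_invariant us" and "last us \<noteq> snd q"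
  shows "trace_invariant (us @ [THE v. succ (last us) v])"
proof -
  note I = inv[unfolded trace_invariant_def]
  have tl: "set (tl us) = snd ` set (vwalk_arcs us)"
    by (simp add: snd_set_vwalk_arcs)
  have bl: "set (butlast us) = fst ` set (vwalk_arcs us)"
    by (simp add: fst_set_vwalk_arcs)
  have ex1: "\<exists>!v. succ (last us) v"
  proof (cases "tl us = []")
    case True
    then have "last us = fst q" using I by (cases us) auto
    then show ?thesis using source_successor by simp
  next
    case False
    then have "last us \<in> set (tl us)" using last_tl last_in_set by metis
    then obtain v where "succ v (last us)" using tl I by auto
    then show ?thesis using successor_of_reached assms(2) by blast
  qed
  define w where "w = (THE v. succ (last us) v)"
  have w: "succ (last us) w" unfolding w_def by (rule theI'[OF ex1])
  have us: "us = butlast us @ [last us]" using I by simp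
  have last: "last us \<notin> set (butlast us)"
    using I us by (metis distinct_append disjoint_iff list.set_intros(1))
  have fresh: "w \<notin> set us"
  proof
    assume "w \<in> set us"
    moreover have "w \<noteq> hd us" using w no_link_into_source I by metis
    ultimately have "w \<in> set (tl us)" using I by (cases us) auto
    then obtain v where v: "(v, w) \<in> set (vwalk_arcs us)" using tl by auto
    then have "v \<in> set (butlast us)" using bl by force
    \<comment> \<open>The trace does not end at the target, so an earlier visit to it would have
      been left along a link.\<close>
    have "w \<noteq> snd q"
    proof
      assume "w = snd q"
      then have "w \<in> set (butlast us)"
        using \<open>w \<in> set us\<close> assms(2) us by (metis Un_iff empty_iff list.set(1) set_ConsD set_append)
      then show False using bl I no_link_out_of_target \<open>w = snd q\<close> by auto
    qed
    then have "w \<in> R" using w by (auto simp: successor_def elementary_links_def)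
    \<comment> \<open>The predecessor of \<open>w\<close> on the trace would have to be its final
      node, yet \<open>v\<close> occurs before the end and nodes are distinct.\<close>
    then have "v = last us" using predecessor_unique w v I by blast
    then show False using last \<open>v \<in> set (butlast us)\<close> by simp
  qed
  have "\<forall>u \<in> set us. \<exists>!v. succ u v"
  proof
    fix u assume "u \<in> set us"
    then have "u \<in> set (butlast us) \<or> u = last us" using us
      by (metis Un_iff empty_iff list.set(1) set_ConsD set_append)
    then show "\<exists>!v. succ u v" using I ex1 by blast
  qed
  then show ?thesis
    using I fresh w unfolding w_def[symmetric] trace_invariant_def
    by (auto simp: set_vwalk_arcs_snoc)
qed

text \<open>The trace consists of distinct nodes from a finite set, so its length is
  bounded.\<close>

lemma trace_terminates:
  obtains us where "trace_nodes I x q k = Some us" "trace_invariant us" "last us = snd q"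
proof -
  let ?n = "card (R \<union> {fst q, snd q})"
  have "\<exists>us. trace_nodes I x q k = Some us"
    unfolding trace_nodes_def
  proof (rule measure_while_option_Some[where P = trace_invariant and f = "\<lambda>us. ?n - length us"])
    fix us assume us: "trace_invariant us" "last us \<noteq> snd q"
    let ?us = "us @ [THE v. succ (last us) v]"
    have inv: "trace_invariant ?us" by (rule trace_invariant_step[OF us])
    have "length ?us = card (set ?us)"
      using inv by (metis distinct_card trace_invariant_def)
    \<comment> \<open>Bounding the extended list, rather than the old one, makes the truncated
      difference drop strictly.\<close>
    also have "\<dots> \<le> ?n"
      by (intro card_mono trace_invariant_nodes inv) (simp add: finite_repeater_nodes)
    finally show "trace_invariant ?us \<and> ?n - length ?us < ?n - length us"
      using inv by simp
  qed (simp add: trace_invariant_def)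
  then obtain us where us: "trace_nodes I x q k = Some us" by blast
  have "trace_invariant us"
    by (rule while_option_rule[OF _ us[unfolded trace_nodes_def]], rule trace_invariant_step)
      (simp_all add: trace_invariant_def)
  moreover have "last us = snd q"
    using while_option_stop[OF us[unfolded trace_nodes_def]] by simp
  ultimately show ?thesis using that us by blast
qed

lemma trace_well_defined: "trace_well_defined I x q k"
proof -
  obtain us where "trace_nodes I x q k = Some us" "trace_invariant us"
    by (rule trace_terminates)
  then show ?thesis by (auto simp: trace_well_defined_def trace_invariant_def)
qed

section \<open>Constraints inherited by a traced path\<close>

lemma traced_path_links:
  assumes "e \<in> set (traced_path I x q k)"
  shows "e \<in> E q" "x q k e = 1"
proof -
  obtain us where "trace_nodes I x q k = Some us" "trace_invariant us"
    by (rule trace_terminates)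
  then have "e \<in> {(u, v). succ u v}"
    using assms by (auto simp: traced_path_def trace_invariant_def)
  then show "e \<in> E q" "x q k e = 1"
    by (auto simp: successor_def)
qed

lemma traced_path_in_demand_paths: "traced_path I x q k \<in> P q"
proof -
  obtain us where us: "trace_nodes I x q k = Some us" "trace_invariant us" "last us = snd q"
    by (rule trace_terminates)
  then have p: "traced_path I x q k = vwalk_arcs us" by (simp add: traced_path_def)
  have "length us \<ge> 2"
    using us demand_ends[OF q] by (cases us; cases "tl us") (auto simp: trace_invariant_def)
  moreover have "set (vwalk_arcs us) \<subseteq> E q"
    using traced_path_links(1) p by auto
  ultimately show ?thesis
    using us(2,3) unfolding p demand_paths_def trace_invariant_def by blast
qed

text \<open>Only an inequality, since the layer may also contain cycles through repeaters off the
  traced path.\<close>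

lemma uses_repeater_traced_path_le:
  assumes "u \<in> R"
  shows "uses_repeater u (traced_path I x q k) \<le> (\<Sum>v | (u, v) \<in> E q. x q k (u, v))"
proof -
  have "uses_repeater u (traced_path I x q k) =
      (\<Sum>v | (u, v) \<in> E q. of_bool ((u, v) \<in> set (traced_path I x q k)))"
    by (rule outgoing_links_of_path[OF q traced_path_in_demand_paths assms, symmetric])
  also have "\<dots> \<le> (\<Sum>v | (u, v) \<in> E q. x q k (u, v))"
    using traced_path_links nonneg[OF q k] by (intro sum_mono) auto
  finally show ?thesis .
qed

lemma length_traced_path_le: "real (length (traced_path I x q k)) \<le> real (max_repeaters I) + 1"
proof -
  let ?p = "traced_path I x q k"
  have "distinct ?p"
    by (rule demand_pathE[OF q traced_path_in_demand_paths]) (blast dest: distinct_map[THEN iffD1])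
  then have "real (length ?p) = (\<Sum>e\<in>set ?p. x q k e)"
    using traced_path_links by (simp add: distinct_card)
  also have "\<dots> \<le> (\<Sum>e\<in>E q. x q k e)"
    using traced_path_links nonneg[OF q k] finite_links by (intro sum_mono2) auto
  also have "\<dots> \<le> real (max_repeaters I) + 1"
    using feas q k by (auto simp: lbf_feasible_def)
  finally show ?thesis .
qed

lemma length_traced_link_le:
  assumes "e \<in> set (traced_path I x q k)"
  shows "link_length I e \<le> max_link_length I"
proof -
  have "link_length I e * x q k e \<le> max_link_length I"
    using feas q k traced_path_links(1)[OF assms] unfolding lbf_feasible_def by blast
  then show ?thesis using traced_path_links(2)[OF assms] by simp
qed

end

section \<open>All layers of a demand together\<close>

lemma sum_uses_repeater_traced_paths_le:
  assumes "q \<in> demands I" "u \<in> R"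
  shows "(\<Sum>k = 1..K. uses_repeater u (traced_path I x q k)) \<le>
    (\<Sum>v | (u, v) \<in> E q. \<Sum>k = 1..K. x q k (u, v))"
  using assms by (subst sum.swap) (intro sum_mono uses_repeater_traced_path_le, auto)

text \<open>Without this fewer than K paths could be chosen. A repeater on a repeated path would be
  used twice; without repeaters the path is \<open>[q]\<close>, and the direct link would be used
  twice.\<close>

lemma inj_traced_path:
  assumes q: "q \<in> demands I"
  shows "inj_on (traced_path I x q) {1..K}"
proof (rule inj_onI, rule ccontr)
  fix k k' assume k: "k \<in> {1..K}" "k' \<in> {1..K}" "k \<noteq> k'"
    and eq: "traced_path I x q k = traced_path I x q k'"
  let ?p = "traced_path I x q k"
  show False
  proof (cases "\<exists>u\<in>R. uses_repeater u ?p \<noteq> 0")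
    case True
    then obtain u where u: "u \<in> R" "uses_repeater u ?p = 1"
      unfolding uses_repeater_def by metis
    have "2 \<le> (\<Sum>k = 1..K. uses_repeater u (traced_path I x q k))"
      using u k eq by (intro sum_ge_two[of _ _ k k']) (auto simp: uses_repeater_def)
    also have "\<dots> \<le> (\<Sum>v | (u, v) \<in> E q. \<Sum>k = 1..K. x q k (u, v))"
      by (rule sum_uses_repeater_traced_paths_le[OF q u(1)])
    also have "\<dots> \<le> 1"
      using feas q u by (auto simp: lbf_feasible_def)
    finally show False by simp
  next
    case False
    then have "?p = [q]"
      using demand_path_no_repeater[OF q traced_path_in_demand_paths[OF q k(1)]] by blast
    then have "x q k q = 1" "x q k' q = 1"
      using traced_path_links(2)[OF q] k eq by (metis list.set_intros(1))+
    then have "2 \<le> (\<Sum>k = 1..K. x q k q)"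
      using k nonneg[OF q] demand_is_link[OF q] by (intro sum_ge_two[of _ _ k k']) auto
    also have "\<dots> \<le> 1"
      using feas q by (auto simp: lbf_feasible_def)
    finally show False by simp
  qed
qed

lemma traced_paths_subset: "traced_paths I x \<subseteq> all_paths I"
  using traced_path_in_demand_paths by (auto simp: traced_paths_def all_paths_def)

lemma paths_of_links_eq_1_iff:
  "paths_of_links I x p = 1 \<longleftrightarrow> (\<exists>q\<in>demands I. \<exists>k\<in>{1..K}. p = traced_path I x q k)"
  unfolding paths_of_links_def traced_paths_def mem_Collect_eq by (metis zero_neq_one)

lemma paths_of_links_cases:
  obtains "paths_of_links I x p = 0"
  | q k where "paths_of_links I x p = 1" "q \<in> demands I" "k \<in> {1..K}" "p = traced_path I x q k"
  using paths_of_links_eq_1_iff[of p] unfolding paths_of_links_def by metis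

lemma bij_traced_path:
  assumes q: "q \<in> demands I"
  shows "bij_betw (traced_path I x q) {1..K} {p \<in> P q. paths_of_links I x p = 1}"
  unfolding bij_betw_def
proof (intro conjI inj_traced_path[OF q] equalityI subsetI)
  fix p assume "p \<in> traced_path I x q ` {1..K}"
  then show "p \<in> {p \<in> P q. paths_of_links I x p = 1}"
    using q traced_path_in_demand_paths unfolding paths_of_links_eq_1_iff by blast
next
  fix p assume "p \<in> {p \<in> P q. paths_of_links I x p = 1}"
  then obtain q' k where p: "p \<in> P q" "q' \<in> demands I" "k \<in> {1..K}" "p = traced_path I x q' k"
    unfolding paths_of_links_eq_1_iff by blast
  \<comment> \<open>\<open>traced_paths\<close> pools all demands; disjointness of the path sets
    recovers the demand that produced \<open>p\<close>.\<close>
  then have "q' = q"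
    using demand_paths_disjoint[OF q p(2)] traced_path_in_demand_paths[OF p(2,3)] by blast
  then show "p \<in> traced_path I x q ` {1..K}" using p by blast
qed

lemma pbf_feasible_paths_of_links: "pbf_feasible I (paths_of_links I x) y"
proof -
  let ?x = "paths_of_links I x"
  have sel: "(\<Sum>p\<in>P q. f p * ?x p) = (\<Sum>k = 1..K. f (traced_path I x q k))"
    if "q \<in> demands I" for q and f :: "_ \<Rightarrow> real"
    by (rule sum_selected[OF finite_demand_paths _ bij_traced_path[OF that]])
      (simp add: paths_of_links_def)
  have usage: "(\<Sum>p\<in>P q. uses_repeater u p * ?x p) \<le>
      (\<Sum>v | (u, v) \<in> E q. \<Sum>k = 1..K. x q k (u, v))" if "q \<in> demands I" "u \<in> R" for q u
    using sum_uses_repeater_traced_paths_le[OF that] sel[OF that(1)] by simp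
  show ?thesis
    unfolding pbf_feasible_def
  proof (intro conjI ballI)
    fix p :: "('v \<times> 'v) list" and e assume "e \<in> set p"
    then show "link_length I e * ?x p \<le> max_link_length I"
      by (cases p rule: paths_of_links_cases)
        (use length_traced_link_le max_link_length_nonneg in simp_all)
  next
    fix p :: "('v \<times> 'v) list"
    show "real (length p) * ?x p \<le> real (max_repeaters I) + 1"
      by (cases p rule: paths_of_links_cases) (use length_traced_path_le in simp_all)
  next
    fix q assume "q \<in> demands I"
    then show "sum ?x (P q) = real K"
      \<comment> \<open>With constant weight 1 the sum counts the K layers.\<close>
      using sel[of q "\<lambda>_. 1"] by simp
  next
    fix u q assume *: "u \<in> R" "q \<in> demands I"
    have "(\<Sum>v | (u, v) \<in> E q. \<Sum>k = 1..K. x q k (u, v)) \<le> 1"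
      using feas * by (auto simp: lbf_feasible_def)
    then show "(\<Sum>p\<in>P q. uses_repeater u p * ?x p) \<le> 1"
      using usage[OF *(2,1)] by simp
  next
    fix u assume u: "u \<in> R"
    have "(\<Sum>p\<in>all_paths I. uses_repeater u p * ?x p) \<le>
        (\<Sum>q\<in>demands I. \<Sum>v | (u, v) \<in> E q. \<Sum>k = 1..K. x q k (u, v))"
      unfolding sum_all_paths by (intro sum_mono usage u)
    also have "\<dots> \<le> real (capacity I) * y u"
      using feas u by (auto simp: lbf_feasible_def)
    finally show "(\<Sum>p\<in>all_paths I. uses_repeater u p * ?x p) \<le> real (capacity I) * y u" .
  qed (use feas in \<open>auto simp: lbf_feasible_def paths_of_links_def\<close>)
qed

end

section \<open>Equivalence\<close>

text \<open>
  Both constructions preserve feasibility and keep \<open>y\<close>, so the two programs have the same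
  feasible vectors \<open>y\<close>; optimality refers only to these.
\<close>

theorem mainTheorem1:
  fixes I :: "('v, 'e) repeater_instance"
  assumes "repeater_network I"
  shows
    "(\<forall>x y ps. pbf_optimal I x y \<and> path_enumeration I ps \<longrightarrow>
        lbf_optimal I (links_of_paths ps x) y) \<and>
     (\<forall>x y. lbf_optimal I x y \<longrightarrow>
        (\<forall>q \<in> demands I. \<forall>k \<in> {1..num_paths I}. trace_well_defined I x q k) \<and>
        traced_paths I x \<subseteq> all_paths I \<and>
        pbf_optimal I (paths_of_links I x) y) \<and>
     (\<forall>xl yl xp yp. lbf_optimal I xl yl \<and> pbf_optimal I xp yp \<longrightarrow>
        (\<Sum>u \<in> repeater_nodes I. yl u) = (\<Sum>u \<in> repeater_nodes I. yp u))"
proof -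
  interpret repeater_network I by (rule assms)
  have sol: "lbf_solution I x y" if "lbf_feasible I x y" for x y
    using that by unfold_locales
  have to_paths: "pbf_feasible I (paths_of_links I x) y" if "lbf_feasible I x y" for x y
    by (rule lbf_solution.pbf_feasible_paths_of_links[OF sol[OF that]])
  \<comment> \<open>Some link variables for the same \<open>y\<close> suffice, so any enumeration of
    the paths will do.\<close>
  have to_links: "\<exists>z. lbf_feasible I z y" if "pbf_feasible I x y" for x y
    using path_enumeration_exists lbf_feasible_links_of_paths[OF that] by blast
  show ?thesis
  proof (intro conjI allI impI ballI)
    fix x y ps assume "pbf_optimal I x y \<and> path_enumeration I ps"
    then show "lbf_optimal I (links_of_paths ps x) y"
      using to_paths lbf_feasible_links_of_paths unfolding pbf_optimal_def lbf_optimal_def by blast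
  next
    fix x y q k assume "lbf_optimal I x y" "q \<in> demands I" "k \<in> {1..num_paths I}"
    then show "trace_well_defined I x q k"
      using lbf_solution.trace_well_defined[OF sol] unfolding lbf_optimal_def by blast
  next
    fix x y assume "lbf_optimal I x y"
    then show "traced_paths I x \<subseteq> all_paths I"
      using lbf_solution.traced_paths_subset[OF sol] unfolding lbf_optimal_def by blast
  next
    fix x y assume "lbf_optimal I x y"
    then show "pbf_optimal I (paths_of_links I x) y"
      using to_paths to_links unfolding pbf_optimal_def lbf_optimal_def by blast
  next
    fix xl yl xp yp assume "lbf_optimal I xl yl \<and> pbf_optimal I xp yp"
    \<comment> \<open>Each optimal \<open>y\<close> is feasible for the other program, which gives
      both inequalities.\<close>
    then have "objective I yl = objective I yp"
      using to_paths to_links unfolding pbf_optimal_def lbf_optimal_def by (meson order_antisym)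
    then show "(\<Sum>u \<in> repeater_nodes I. yl u) = (\<Sum>u \<in> repeater_nodes I. yp u)"
      by (simp add: objective_def)
  qed
qed

end
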